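(* Let $\theta_w\ge1$ and $\theta_p\ge0$ be integers, and let $w:\mathbb{R}_+\to\mathbb{R}$ be an ordinary function (no delta terms) whose Laplace transform $\hat w$ is rational with a zero of order exactly $\theta_w$ at infinity. Let $X_{(\theta_w,\theta_p)}$ be the set of $e\in C_0(\mathbb{R}_+)$ such that $\hat e$ is rational, $\hat e$ has a zero of order at least $\theta_w$ at infinity, and $\hat e-\hat w$ has a zero of order at least $\theta_p+\theta_w$ at infinity. Then the closure of $X_{(\theta_w,\theta_p)}$ in $C_0(\mathbb{R}_+)$ is $$\overline{X_{(\theta_w,\theta_p)}}=\begin{cases}C_{0,\alpha}(\mathbb{R}_+)\ \text{ with }\alpha=w(0+)&\text{if }\theta_p>0,\ \theta_w=1,\\ C_0(\mathbb{R}_+)&\text{if }\theta_p=0,\ \theta_w=1,\\ C_{0,0}(\mathbb{R}_+)&\text{if }\theta_w>1.\end{cases}$$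
   Context: $\mathbb{R}_+=[0,\infty)$; $\hat g$ denotes the Laplace transform of $g$. $C_0(\mathbb{R}_+)$ is the space of continuous $\varphi:\mathbb{R}_+\to\mathbb{R}$ with $\lim_{t\to\infty}\varphi(t)=0$, with the supremum norm; for $\alpha\in\mathbb{R}$, $C_{0,\alpha}(\mathbb{R}_+)=\{\varphi\in C_0(\mathbb{R}_+)\mid\varphi(0)=\alpha\}$. A rational function has a zero of order at least $k$ at infinity if it is $O(|s|^{-k})$ as $|s|\to\infty$. *)

theory Defs
  imports "HOL-Analysis.Analysis" "HOL-Library.Landau_Symbols"
    "HOL-Computational_Algebra.Polynomial"
begin

text \<open>
  A function on \<open>{0..}\<close> is represented by its extensional extension to \<open>real\<close>
  (\<open>undefined\<close> at negative arguments), so that the elements of \<open>C0\<close> correspond one-to-one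
  to functions on the half-line.
\<close>

definition C0 :: "(real \<Rightarrow> real) set" where
  "C0 = {\<phi> \<in> extensional {0..}. continuous_on {0..} \<phi> \<and> (\<phi> \<longlongrightarrow> 0) at_top}"

definition C0_at :: "real \<Rightarrow> (real \<Rightarrow> real) set" where
  "C0_at \<alpha> = {\<phi> \<in> C0. \<phi> 0 = \<alpha>}"

text \<open>\<open>cfunspace\<close> carries the supremum metric; see \<open>mspace_C0\<close> and \<open>mdist_C0\<close> below.\<close>

definition C0_metric :: "(real \<Rightarrow> real) metric" where
  "C0_metric = submetric (cfunspace (top_of_set {0..}) euclidean_metric) C0"

definition laplace_integrable :: "(real \<Rightarrow> real) \<Rightarrow> complex \<Rightarrow> bool" where
  "laplace_integrable g s \<longleftrightarrow>
     set_integrable lebesgue {0..} (\<lambda>t. exp (- s * of_real t) * of_real (g t))"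

definition laplace :: "(real \<Rightarrow> real) \<Rightarrow> complex \<Rightarrow> complex" where
  "laplace g s = (LINT t:{0..}|lebesgue. exp (- s * of_real t) * of_real (g t))"

text \<open>The value of a rational function at a root of the chosen denominator is irrelevant.\<close>

definition rational_function :: "(complex \<Rightarrow> complex) \<Rightarrow> bool" where
  "rational_function R \<longleftrightarrow> (\<exists>p q. q \<noteq> 0 \<and> (\<forall>s. R s = poly p s / poly q s))"

text \<open>
  The integral defining the transform of \<open>g\<close> converges only on some right half-plane. The
  rational function \<open>R\<close> agreeing with it there is its continuation to the whole plane,
  unique up to values at finitely many points.
\<close>

definition has_rational_laplace :: "(real \<Rightarrow> real) \<Rightarrow> (complex \<Rightarrow> complex) \<Rightarrow> bool" where
  "has_rational_laplace g R \<longleftrightarrow> rational_function R \<and>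
     (\<exists>\<sigma>. \<forall>s. Re s > \<sigma> \<longrightarrow> laplace_integrable g s \<and> laplace g s = R s)"

definition zero_at_infinity_ge :: "nat \<Rightarrow> (complex \<Rightarrow> complex) \<Rightarrow> bool" where
  "zero_at_infinity_ge k R \<longleftrightarrow> R \<in> O[at_infinity](\<lambda>s. of_real (1 / cmod s ^ k))"

definition zero_at_infinity_eq :: "nat \<Rightarrow> (complex \<Rightarrow> complex) \<Rightarrow> bool" where
  "zero_at_infinity_eq k R \<longleftrightarrow> zero_at_infinity_ge k R \<and> \<not> zero_at_infinity_ge (Suc k) R"

text \<open>\<open>W\<close> is the rational transform of the weight \<open>w\<close>.\<close>

definition X_set :: "(complex \<Rightarrow> complex) \<Rightarrow> nat \<Rightarrow> nat \<Rightarrow> (real \<Rightarrow> real) set" where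
  "X_set W \<theta>\<^sub>w \<theta>\<^sub>p = {e \<in> C0. \<exists>E. has_rational_laplace e E \<and> zero_at_infinity_ge \<theta>\<^sub>w E \<and>
      zero_at_infinity_ge (\<theta>\<^sub>p + \<theta>\<^sub>w) (\<lambda>s. E s - W s)}"

lemma C0_bounded:
  assumes "\<phi> \<in> C0"
  shows "bounded (\<phi> ` {0..})"
proof -
  have c: "continuous_on {0..} \<phi>" and l: "(\<phi> \<longlongrightarrow> 0) at_top"
    using assms by (auto simp: C0_def)
  from tendstoD [OF l, of 1] obtain T where T: "\<And>t. t \<ge> T \<Longrightarrow> \<bar>\<phi> t\<bar> < 1"
    by (auto simp: eventually_at_top_linorder)
  have "bounded (\<phi> ` {0..max 0 T})"
    by (rule compact_imp_bounded, rule compact_continuous_image)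
       (auto intro: continuous_on_subset [OF c])
  moreover have "bounded (\<phi> ` {max 0 T..})"
    unfolding bounded_iff by (rule exI [of _ 1]) (auto dest!: T)
  moreover have "{0..} = {0..max 0 T} \<union> {max 0 T..}" by auto
  ultimately show ?thesis by (metis bounded_Un image_Un)
qed

lemma C0_subset_cfunspace:
  "C0 \<subseteq> mspace (cfunspace (top_of_set {0..}) (euclidean_metric :: real metric))"
  using C0_bounded by (auto simp: C0_def)

lemma mspace_C0: "mspace C0_metric = C0"
  using C0_subset_cfunspace by (auto simp: C0_metric_def)

lemma mdist_C0:
  assumes "f \<in> C0" "g \<in> C0"
  shows "mdist C0_metric f g = (SUP t\<in>{0..}. \<bar>f t - g t\<bar>)"
proof -
  have "f \<in> Met_TC.fspace {0..}" "g \<in> Met_TC.fspace {0..}"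
    using assms C0_bounded by (auto simp: Met_TC.fspace_def C0_def)
  then show ?thesis
    by (simp add: C0_metric_def mdist_cfunspace_eq_mdist_funspace Met_TC.fdist_def dist_real_def)
qed

end

theory Submission
  imports Defs
begin

text \<open>
  Prescribing the order of the zero of \<open>E - W\<close> at infinity prescribes the first
  \<open>\<theta>\<^sub>p + \<theta>\<^sub>w - 1\<close> coefficients in the expansion of the transform \<open>E\<close> in powers of \<open>1 / s\<close>, that is,
  the values at \<open>0\<close> of \<open>e\<close> and of its first derivatives. Among these only the value \<open>e 0\<close> is a
  continuous functional for the supremum norm, so it is the only condition that survives in the
  closure.

  That it does survive is the initial value theorem (\<open>initial_value_theorem\<close>): the coefficient of
  \<open>1 / s\<close> is the limit of the function at \<open>0\<close>. For the weight this coefficient is \<open>w(0+)\<close> if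
  \<open>\<theta>\<^sub>w = 1\<close>, and \<open>0\<close> if \<open>\<theta>\<^sub>w > 1\<close>. For \<open>\<theta>\<^sub>w = 1\<close> and \<open>\<theta>\<^sub>p = 0\<close> no coefficient is prescribed.

  For the converse everything is written in the variable \<open>x = exp (- t)\<close>, in which \<open>C0\<close> becomes the
  space of continuous functions on the unit interval that vanish at \<open>x = 0\<close>. The polynomials
  \<open>x ^ k * (1 - x) ^ n\<close> (\<open>bump\<close>) with \<open>k \<ge> 1\<close> have elementary rational transforms
  (\<open>has_laplace_bump\<close>), and by Bernstein's theorem their combinations are dense
  (\<open>C0_approximation_by_bumps\<close>). Such an approximation is then corrected one coefficient at a time:
  the transform of \<open>x ^ M * (1 - x) ^ n\<close> is \<open>n! / s ^ (n + 1)\<close> to leading order, whatever \<open>M\<close> is,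
  while for \<open>n \<ge> 1\<close> the function itself tends uniformly to \<open>0\<close> as \<open>M\<close> grows (\<open>bump_Suc_le\<close>). So each
  coefficient beyond the first is adjusted at arbitrarily small cost
  (\<open>approximate_with_coefficients\<close>).
\<close>

section \<open>Rational functions near infinity\<close>

lemma zero_at_infinity_ge_iff:
  "zero_at_infinity_ge k R \<longleftrightarrow> (\<exists>C. \<forall>\<^sub>F s in at_infinity. cmod (s ^ k * R s) \<le> C)"
proof -
  have ev: "\<forall>\<^sub>F s::complex in at_infinity. s \<noteq> 0"
    by (rule eventually_at_infinityI[of 1]) auto
  have eq: "cmod (R s) \<le> C * norm (complex_of_real (1 / cmod s ^ k)) \<longleftrightarrow> cmod (s ^ k * R s) \<le> C"
    if "s \<noteq> 0" for s C
    using that by (simp add: norm_mult norm_power norm_divide field_simps)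
  show ?thesis
  proof
    assume "zero_at_infinity_ge k R"
    then obtain C where "\<forall>\<^sub>F s in at_infinity. cmod (R s) \<le> C * norm (complex_of_real (1 / cmod s ^ k))"
      unfolding zero_at_infinity_ge_def by (blast elim: landau_o.bigE)
    with ev have "\<forall>\<^sub>F s in at_infinity. cmod (s ^ k * R s) \<le> C"
      by eventually_elim (rule eq[THEN iffD1])
    then show "\<exists>C. \<forall>\<^sub>F s in at_infinity. cmod (s ^ k * R s) \<le> C" by blast
  next
    assume "\<exists>C. \<forall>\<^sub>F s in at_infinity. cmod (s ^ k * R s) \<le> C"
    then obtain C where "\<forall>\<^sub>F s in at_infinity. cmod (s ^ k * R s) \<le> C" by blast
    with ev have "\<forall>\<^sub>F s in at_infinity. cmod (R s) \<le> C * norm (complex_of_real (1 / cmod s ^ k))"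
      by eventually_elim (rule eq[THEN iffD2])
    then show "zero_at_infinity_ge k R"
      unfolding zero_at_infinity_ge_def by (rule bigoI)
  qed
qed

lemma tendsto_imp_zero_at_infinity_ge:
  assumes "((\<lambda>s. s ^ k * R s) \<longlongrightarrow> c) at_infinity"
  shows "zero_at_infinity_ge k R"
proof -
  have "\<forall>\<^sub>F s in at_infinity. dist (s ^ k * R s) c < 1"
    using assms by (rule tendstoD) simp
  then have "\<forall>\<^sub>F s in at_infinity. cmod (s ^ k * R s) \<le> cmod c + 1"
    by eventually_elim (smt (verit) dist_norm norm_triangle_sub)
  then show ?thesis unfolding zero_at_infinity_ge_iff by blast
qed

lemma zero_at_infinity_ge_add:
  "\<lbrakk>zero_at_infinity_ge k R; zero_at_infinity_ge k S\<rbrakk> \<Longrightarrow> zero_at_infinity_ge k (\<lambda>s. R s + S s)"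
  unfolding zero_at_infinity_ge_def by (rule sum_in_bigo)

lemma zero_at_infinity_ge_mono:
  assumes "zero_at_infinity_ge k R" "j \<le> k"
  shows "zero_at_infinity_ge j R"
proof -
  obtain C where "\<forall>\<^sub>F s in at_infinity. cmod (s ^ k * R s) \<le> C"
    using assms(1) unfolding zero_at_infinity_ge_iff by blast
  moreover have "\<forall>\<^sub>F s::complex in at_infinity. cmod s \<ge> 1"
    by (rule eventually_at_infinityI[of 1]) auto
  ultimately have "\<forall>\<^sub>F s in at_infinity. cmod (s ^ j * R s) \<le> C"
  proof eventually_elim
    case (elim s)
    have "cmod (s ^ j * R s) \<le> cmod (s ^ k * R s)"
      using elim(2) assms(2) by (simp add: norm_mult norm_power mult_right_mono power_increasing)
    with elim(1) show ?case by linarith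
  qed
  then show ?thesis unfolding zero_at_infinity_ge_iff by blast
qed

lemma zero_at_infinity_ge_cong:
  assumes "\<forall>\<^sub>F s in at_infinity. R s = S s"
  shows "zero_at_infinity_ge k R \<longleftrightarrow> zero_at_infinity_ge k S"
  unfolding zero_at_infinity_ge_def by (rule landau_o.big.in_cong) (rule assms)

lemma zero_at_infinity_ge_Suc_imp_tendsto_0:
  assumes "zero_at_infinity_ge (Suc k) R"
  shows "((\<lambda>s. s ^ k * R s) \<longlongrightarrow> 0) at_infinity"
proof -
  obtain C where "\<forall>\<^sub>F s in at_infinity. cmod (s ^ Suc k * R s) \<le> C"
    using assms unfolding zero_at_infinity_ge_iff by blast
  then have "Bfun (\<lambda>s. s ^ Suc k * R s) at_infinity" by (rule BfunI)
  moreover have "Zfun (\<lambda>s::complex. inverse s) at_infinity"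
    using tendsto_inverse_0 by (simp only: tendsto_Zfun_iff diff_0_right)
  ultimately have "Zfun (\<lambda>s. inverse s * (s ^ Suc k * R s)) at_infinity"
    by (intro bounded_bilinear.Zfun_prod_Bfun[OF bounded_bilinear_mult])
  then have "((\<lambda>s. inverse s * (s ^ Suc k * R s)) \<longlongrightarrow> 0) at_infinity"
    by (simp only: tendsto_Zfun_iff diff_0_right)
  moreover have "\<forall>\<^sub>F s in at_infinity. inverse s * (s ^ Suc k * R s) = s ^ k * R s"
  proof (rule eventually_at_infinityI[of 1])
    fix s :: complex assume "1 \<le> cmod s"
    then have "s \<noteq> 0" by auto
    then show "inverse s * (s ^ Suc k * R s) = s ^ k * R s" by simp
  qed
  ultimately show ?thesis by (rule Lim_transform_eventually)
qed

lemma eventually_poly_neq_0_at_infinity: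
  fixes q :: "complex poly"
  assumes "q \<noteq> 0"
  shows "\<forall>\<^sub>F s in at_infinity. poly q s \<noteq> 0"
proof -
  obtain B where "\<And>s. poly q s = 0 \<Longrightarrow> cmod s \<le> B"
    using poly_roots_finite[OF assms, THEN finite_imp_bounded] by (auto simp: bounded_iff)
  then show ?thesis by (intro eventually_at_infinityI[of "B + 1"]) fastforce
qed

text \<open>
  Subtracting the right multiple \<open>c\<close> of \<open>q\<close> from \<open>p\<close> cancels the coefficient at
  \<open>degree q\<close>, and the remaining quotient tends to \<open>0\<close>.
\<close>

lemma tendsto_poly_divide_at_infinity:
  fixes p q :: "complex poly"
  assumes "degree p \<le> degree q" "q \<noteq> 0"
  shows "\<exists>c. ((\<lambda>s. poly p s / poly q s) \<longlongrightarrow> c) at_infinity"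
proof -
  define c where "c = coeff p (degree q) / lead_coeff q"
  define r where "r = p - smult c q"
  note q = eventually_poly_neq_0_at_infinity[OF assms(2)]
  have "degree r \<le> degree q" unfolding r_def
    by (intro degree_diff_le assms(1) degree_smult_le)
  moreover have "coeff r (degree q) = 0" using assms(2) by (simp add: r_def c_def)
  ultimately have "r = 0 \<or> degree r < degree q"
    using eq_zero_or_degree_less by blast
  then have "((\<lambda>s. poly r s / poly q s) \<longlongrightarrow> 0) at_infinity"
    using poly_divide_tendsto_0_at_infinity by auto
  then have "((\<lambda>s. poly r s / poly q s + c) \<longlongrightarrow> 0 + c) at_infinity"
    by (intro tendsto_intros)
  moreover have "\<forall>\<^sub>F s in at_infinity. poly r s / poly q s + c = poly p s / poly q s"
    using q by eventually_elim (simp add: r_def field_simps)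
  ultimately show ?thesis by (blast intro: Lim_transform_eventually)
qed

lemma poly_divide_not_tendsto_0_inverse:
  fixes p q :: "complex poly"
  assumes "p \<noteq> 0" "q \<noteq> 0"
    and "((\<lambda>s. (poly p s / poly q s) * (poly q s / poly p s)) \<longlongrightarrow> 0) at_infinity"
  shows False
proof -
  have "\<forall>\<^sub>F s in at_infinity. (poly p s / poly q s) * (poly q s / poly p s) = 1"
    using eventually_poly_neq_0_at_infinity[OF assms(1)] eventually_poly_neq_0_at_infinity[OF assms(2)]
    by eventually_elim simp
  then have "((\<lambda>s::complex. 1::complex) \<longlongrightarrow> 0) at_infinity"
    using assms(3) by (rule Lim_transform_eventually[rotated])
  from tendsto_unique[OF trivial_limit_at_infinity tendsto_const this] show False by simp
qed

text \<open>
  Since \<open>x / 0 = 0\<close>, a pointwise sum of two quotients of polynomials need not be a quotient of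
  polynomials at the poles. Asking for agreement near infinity only gives a class that is closed
  under pointwise arithmetic and still sees everything about orders of zeros at infinity.
\<close>

definition rational_at_infinity :: "(complex \<Rightarrow> complex) \<Rightarrow> bool" where
  "rational_at_infinity R \<longleftrightarrow>
     (\<exists>p q. q \<noteq> 0 \<and> (\<forall>\<^sub>F s in at_infinity. R s = poly p s / poly q s))"

lemma rational_function_imp_at_infinity:
  assumes "rational_function R"
  shows "rational_at_infinity R"
proof -
  obtain p q where "q \<noteq> 0" "\<forall>s. R s = poly p s / poly q s"
    using assms unfolding rational_function_def by blast
  then show ?thesis
    unfolding rational_at_infinity_def by (intro exI[of _ p] exI[of _ q]) simp
qed

lemma rational_at_infinity_const: "rational_at_infinity (\<lambda>s. c)"
  unfolding rational_at_infinity_def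
  by (rule exI[of _ "[:c:]"], rule exI[of _ 1]) simp

lemma rational_at_infinity_inverse_linear: "rational_at_infinity (\<lambda>s. 1 / (s + c))"
  unfolding rational_at_infinity_def
  by (rule exI[of _ 1], rule exI[of _ "[:c, 1:]"]) (simp add: add.commute)

lemma rational_at_infinity_add:
  assumes "rational_at_infinity R" "rational_at_infinity S"
  shows "rational_at_infinity (\<lambda>s. R s + S s)"
proof -
  obtain p q p' q' where q: "q \<noteq> 0" "q' \<noteq> 0"
    and ev: "\<forall>\<^sub>F s in at_infinity. R s = poly p s / poly q s"
      "\<forall>\<^sub>F s in at_infinity. S s = poly p' s / poly q' s"
    using assms unfolding rational_at_infinity_def by blast
  have "\<forall>\<^sub>F s in at_infinity. R s + S s = poly (p * q' + p' * q) s / poly (q * q') s"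
    using ev q[THEN eventually_poly_neq_0_at_infinity]
    by eventually_elim (simp add: field_simps)
  moreover have "q * q' \<noteq> 0" using q by simp
  ultimately show ?thesis unfolding rational_at_infinity_def by (intro exI conjI)
qed

lemma rational_at_infinity_mult:
  assumes "rational_at_infinity R" "rational_at_infinity S"
  shows "rational_at_infinity (\<lambda>s. R s * S s)"
proof -
  obtain p q p' q' where q: "q \<noteq> 0" "q' \<noteq> 0"
    and ev: "\<forall>\<^sub>F s in at_infinity. R s = poly p s / poly q s"
      "\<forall>\<^sub>F s in at_infinity. S s = poly p' s / poly q' s"
    using assms unfolding rational_at_infinity_def by blast
  have "\<forall>\<^sub>F s in at_infinity. R s * S s = poly (p * p') s / poly (q * q') s"
    using ev by eventually_elim simp
  moreover have "q * q' \<noteq> 0" using q by simp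
  ultimately show ?thesis unfolding rational_at_infinity_def by (intro exI conjI)
qed

lemma rational_at_infinity_diff:
  assumes "rational_at_infinity R" "rational_at_infinity S"
  shows "rational_at_infinity (\<lambda>s. R s - S s)"
  using rational_at_infinity_add[OF assms(1)
      rational_at_infinity_mult[OF rational_at_infinity_const[of "-1"] assms(2)]] by simp

lemma rational_power_mult:
  assumes "rational_at_infinity R"
  obtains p q where "q \<noteq> 0" "\<forall>\<^sub>F s in at_infinity. s ^ k * R s = poly p s / poly q s"
proof -
  obtain p q where q: "q \<noteq> 0" and ev: "\<forall>\<^sub>F s in at_infinity. R s = poly p s / poly q s"
    using assms unfolding rational_at_infinity_def by blast
  have "\<forall>\<^sub>F s in at_infinity. s ^ k * R s = poly (monom 1 k * p) s / poly q s"
    using ev by eventually_elim (simp add: poly_monom)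
  with q show thesis by (rule that)
qed

text \<open>
  Boundedness of \<open>s ^ k * R s = p / q\<close> excludes \<open>degree p > degree q\<close>: in that case \<open>q / p\<close>
  would tend to \<open>0\<close>, and so would its product with the bounded \<open>p / q\<close>, which is \<open>1\<close>.
\<close>

lemma rational_leading_coefficient:
  assumes "rational_at_infinity R" "zero_at_infinity_ge k R"
  shows "\<exists>c. ((\<lambda>s. s ^ k * R s) \<longlongrightarrow> c) at_infinity"
proof -
  obtain p q where q: "q \<noteq> 0" and eq: "\<forall>\<^sub>F s in at_infinity. s ^ k * R s = poly p s / poly q s"
    by (rule rational_power_mult[OF assms(1), where k = k])
  have "degree p \<le> degree q"
  proof (rule ccontr)
    assume *: "\<not> degree p \<le> degree q"
    then have p: "p \<noteq> 0" by auto
    have "((\<lambda>s. poly q s / poly p s) \<longlongrightarrow> 0) at_infinity"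
      using * by (intro poly_divide_tendsto_0_at_infinity) auto
    moreover obtain C where "\<forall>\<^sub>F s in at_infinity. cmod (s ^ k * R s) \<le> C"
      using assms(2) unfolding zero_at_infinity_ge_iff by blast
    with eq have "\<forall>\<^sub>F s in at_infinity. cmod (poly p s / poly q s) \<le> C"
      by eventually_elim simp
    then have "Bfun (\<lambda>s. poly p s / poly q s) at_infinity" by (rule BfunI)
    ultimately have "Zfun (\<lambda>s. (poly q s / poly p s) * (poly p s / poly q s)) at_infinity"
      by (intro bounded_bilinear.Zfun_prod_Bfun[OF bounded_bilinear_mult])
         (simp_all only: tendsto_Zfun_iff diff_0_right)
    then have "((\<lambda>s. (poly q s / poly p s) * (poly p s / poly q s)) \<longlongrightarrow> 0) at_infinity"
      by (simp only: tendsto_Zfun_iff diff_0_right)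
    then show False using poly_divide_not_tendsto_0_inverse[OF q p] by blast
  qed
  then show ?thesis unfolding tendsto_cong[OF eq] using q by (rule tendsto_poly_divide_at_infinity)
qed

text \<open>
  The order of a zero of a rational function at infinity is an integer: once \<open>s ^ k * R s\<close>
  vanishes at infinity, it does so at least as fast as \<open>1 / s\<close>. This is what makes it possible to
  raise the order by one by removing a single coefficient.
\<close>

lemma rational_zero_at_infinity_Suc:
  assumes "rational_at_infinity R" "((\<lambda>s. s ^ k * R s) \<longlongrightarrow> 0) at_infinity"
  shows "zero_at_infinity_ge (Suc k) R"
proof -
  obtain p q where q: "q \<noteq> 0" and eq: "\<forall>\<^sub>F s in at_infinity. s ^ k * R s = poly p s / poly q s"
    by (rule rational_power_mult[OF assms(1), where k = k])
  have lim: "((\<lambda>s. poly p s / poly q s) \<longlongrightarrow> 0) at_infinity"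
    using assms(2) unfolding tendsto_cong[OF eq] .
  have "p = 0 \<or> degree p < degree q"
  proof (rule ccontr)
    assume *: "\<not> (p = 0 \<or> degree p < degree q)"
    then obtain c where "((\<lambda>s. poly q s / poly p s) \<longlongrightarrow> c) at_infinity"
      using tendsto_poly_divide_at_infinity[of q p] by auto
    from tendsto_mult[OF lim this] show False
      using poly_divide_not_tendsto_0_inverse[OF _ q] * by auto
  qed
  then have "degree ([:0, 1:] * p) \<le> degree q"
    using degree_mult_le[of "[:0,1:]" p] by auto
  then obtain c where "((\<lambda>s. poly ([:0, 1:] * p) s / poly q s) \<longlongrightarrow> c) at_infinity"
    using tendsto_poly_divide_at_infinity q by blast
  moreover have "\<forall>\<^sub>F s in at_infinity. poly ([:0, 1:] * p) s / poly q s = s ^ Suc k * R s"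
    using eq
  proof eventually_elim
    case (elim s)
    have "poly ([:0, 1:] * p) s / poly q s = s * (poly p s / poly q s)" by simp
    then show ?case by (simp add: elim[symmetric] mult.assoc del: times_divide_eq_right)
  qed
  ultimately have "((\<lambda>s. s ^ Suc k * R s) \<longlongrightarrow> c) at_infinity"
    by (rule Lim_transform_eventually)
  then show ?thesis by (rule tendsto_imp_zero_at_infinity_ge)
qed

section \<open>Laplace transforms that are rational near infinity\<close>

text \<open>
  The variant of \<^const>\<open>has_rational_laplace\<close> in which the transform is rational near infinity
  only. It is compatible with linear combinations, and passing between the two notions changes the
  transform on a bounded set at most.
\<close>

definition has_laplace :: "(real \<Rightarrow> real) \<Rightarrow> (complex \<Rightarrow> complex) \<Rightarrow> bool" where
  "has_laplace g R \<longleftrightarrow> rational_at_infinity R \<and>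
     (\<exists>\<sigma>. \<forall>s. Re s > \<sigma> \<longrightarrow> laplace_integrable g s \<and> laplace g s = R s)"

lemma has_rational_laplace_imp_has_laplace: "has_rational_laplace g R \<Longrightarrow> has_laplace g R"
  unfolding has_rational_laplace_def has_laplace_def
  by (blast intro: rational_function_imp_at_infinity)

text \<open>
  The half-plane of convergence is shrunk until it avoids the bounded set on which \<open>R\<close> differs
  from a quotient of polynomials.
\<close>

lemma has_laplace_imp_has_rational_laplace:
  assumes "has_laplace g R"
  obtains T where "has_rational_laplace g T" "\<forall>\<^sub>F s in at_infinity. T s = R s"
proof -
  obtain \<sigma> p q where q: "q \<noteq> 0" and ev: "\<forall>\<^sub>F s in at_infinity. R s = poly p s / poly q s"
    and *: "\<forall>s. Re s > \<sigma> \<longrightarrow> laplace_integrable g s \<and> laplace g s = R s"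
    using assms unfolding has_laplace_def rational_at_infinity_def by blast
  define T where "T = (\<lambda>s. poly p s / poly q s)"
  obtain B where B: "\<And>s. cmod s \<ge> B \<Longrightarrow> R s = T s"
    using ev unfolding eventually_at_infinity T_def by blast
  have "laplace_integrable g s \<and> laplace g s = T s" if "Re s > max \<sigma> B" for s
  proof -
    have "cmod s \<ge> B" using that complex_Re_le_cmod[of s] by simp
    then show ?thesis using * B that by simp
  qed
  moreover have "rational_function T" unfolding rational_function_def T_def using q by blast
  ultimately have "has_rational_laplace g T" unfolding has_rational_laplace_def by blast
  moreover have "\<forall>\<^sub>F s in at_infinity. T s = R s"
    using ev by eventually_elim (simp add: T_def)
  ultimately show thesis by (rule that)
qed

lemma has_laplace_cong:
  assumes "\<And>t. t \<ge> 0 \<Longrightarrow> f t = g t"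
  shows "has_laplace f R \<longleftrightarrow> has_laplace g R"
proof -
  have "laplace_integrable f s = laplace_integrable g s" for s
    unfolding laplace_integrable_def by (rule set_integrable_cong) (auto simp: assms)
  moreover have "laplace f s = laplace g s" for s
    unfolding laplace_def by (rule set_lebesgue_integral_cong) (auto simp: assms)
  ultimately show ?thesis unfolding has_laplace_def by simp
qed

lemma has_laplace_add:
  assumes "has_laplace f R" "has_laplace g S"
  shows "has_laplace (\<lambda>t. f t + g t) (\<lambda>s. R s + S s)"
proof -
  obtain \<sigma> \<tau> where *: "\<And>s. Re s > \<sigma> \<Longrightarrow> laplace_integrable f s \<and> laplace f s = R s"
    "\<And>s. Re s > \<tau> \<Longrightarrow> laplace_integrable g s \<and> laplace g s = S s"
    using assms unfolding has_laplace_def by blast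
  have "laplace_integrable (\<lambda>t. f t + g t) s \<and> laplace (\<lambda>t. f t + g t) s = R s + S s"
    if "Re s > max \<sigma> \<tau>" for s
    using *(1)[of s] *(2)[of s] that
    by (simp add: laplace_integrable_def laplace_def distrib_left set_integral_add)
  then show ?thesis
    using assms rational_at_infinity_add unfolding has_laplace_def by blast
qed

lemma has_laplace_cmult:
  assumes "has_laplace f R"
  shows "has_laplace (\<lambda>t. c * f t) (\<lambda>s. of_real c * R s)"
proof -
  obtain \<sigma> where *: "\<And>s. Re s > \<sigma> \<Longrightarrow> laplace_integrable f s \<and> laplace f s = R s"
    using assms unfolding has_laplace_def by blast
  have "laplace_integrable (\<lambda>t. c * f t) s \<and> laplace (\<lambda>t. c * f t) s = of_real c * R s"
    if "Re s > \<sigma>" for s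
  proof -
    have "exp (- s * of_real t) * of_real (c * f t) =
        of_real c * (exp (- s * of_real t) * of_real (f t))" for t by simp
    then show ?thesis
      using *[OF that] unfolding laplace_integrable_def laplace_def
      by (simp only: set_integral_mult_right set_integrable_mult_right simp_thms)
  qed
  then show ?thesis
    using assms rational_at_infinity_mult[OF rational_at_infinity_const] unfolding has_laplace_def by blast
qed

lemma has_laplace_zero: "has_laplace (\<lambda>t. 0) (\<lambda>s. 0)"
  unfolding has_laplace_def laplace_integrable_def laplace_def
  by (simp add: rational_at_infinity_const set_integrable_def)

lemma has_laplace_sum:
  assumes "finite I" "\<And>i. i \<in> I \<Longrightarrow> has_laplace (f i) (R i)"
  shows "has_laplace (\<lambda>t. \<Sum>i\<in>I. f i t) (\<lambda>s. \<Sum>i\<in>I. R i s)"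
  using assms by (induction I) (simp_all add: has_laplace_zero has_laplace_add)

lemma set_integrable_exp_complex:
  assumes "Re z > 0"
  shows "set_integrable lebesgue {0..} (\<lambda>t. exp (- z * of_real t))"
proof (rule measurable_bounded_by_integrable_imp_absolutely_integrable)
  show "(\<lambda>t. exp (- z * of_real t)) \<in> borel_measurable (lebesgue_on {0..})"
    by (intro continuous_imp_measurable_on_sets_lebesgue continuous_intros) auto
  show "(\<lambda>t. exp (- Re z * t)) integrable_on {0..}"
    using assms by (rule integrable_on_exp_minus_to_infinity)
qed auto

lemma set_integral_exp_complex:
  assumes "Re z > 0"
  shows "(LINT t:{0..}|lebesgue. exp (- z * of_real t)) = 1 / z"
proof -
  let ?f = "\<lambda>t. exp (- z * complex_of_real t)"
  let ?F = "\<lambda>t. - exp (- z * complex_of_real t) / z"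
  have z: "z \<noteq> 0" using assms by auto
  have abs: "?f absolutely_integrable_on {0..}"
    using set_integrable_exp_complex[OF assms] .
  have "set_integrable lebesgue {0<..} ?f"
    using abs by (rule set_integrable_subset) auto
  then have int: "set_integrable lborel {0<..} ?f"
    unfolding set_integrable_def by (subst (asm) integrable_completion) auto
  have "(LBINT t=0..\<infinity>. ?f t) = 0 - (- 1 / z)"
  proof (rule interval_integral_FTC_integrable)
    show "(?F has_vector_derivative ?f t) (at t)" for t
      using z by (auto intro!: derivative_eq_intros has_vector_derivative_real_field simp: field_simps)
    show "set_integrable lborel (einterval 0 \<infinity>) ?f"
      using int by (simp add: zero_ereal_def)
    have "(?F \<longlongrightarrow> - exp (- z * complex_of_real 0) / z) (at_right 0)"
      by (intro tendsto_intros) (use z in auto)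
    then show "((?F \<circ> real_of_ereal) \<longlongrightarrow> - 1 / z) (at_right 0)"
      by (simp add: zero_ereal_def ereal_tendsto_simps)
    \<comment> \<open>The antiderivative vanishes at infinity because its norm does.\<close>
    have "((\<lambda>t. cmod (?F t)) \<longlongrightarrow> 0) at_top"
    proof -
      have "((\<lambda>t. exp (- (c * t)) / d) \<longlongrightarrow> 0) at_top" if "c > 0" for c d :: real
      proof -
        have "((\<lambda>t. exp (- (c * t))) \<longlongrightarrow> 0) at_top" using that by real_asymp
        then show ?thesis by (rule tendsto_divide_zero)
      qed
      then show ?thesis using assms by (simp add: norm_divide)
    qed
    then show "((?F \<circ> real_of_ereal) \<longlongrightarrow> 0) (at_left \<infinity>)"
      unfolding ereal_tendsto_simps by (rule tendsto_norm_zero_cancel)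
  qed (auto intro!: continuous_intros)
  then have "(LBINT t:{0<..}. ?f t) = 1 / z"
    by (simp add: interval_integral_to_infinity_eq zero_ereal_def)
  moreover have "(LBINT t:{0<..}. ?f t) = integral {0<..} ?f"
    using int by (rule set_borel_integral_eq_integral)
  moreover have "integral {0<..} ?f = integral {0..} ?f"
    by (rule integral_spike_set; rule negligible_subset[of "{0}"]) auto
  ultimately show ?thesis using set_lebesgue_integral_eq_integral(2)[OF abs] by simp
qed

lemma laplace_exp:
  assumes "Re s > - a"
  shows "laplace_integrable (\<lambda>t. exp (- (a * t))) s" "laplace (\<lambda>t. exp (- (a * t))) s = 1 / (s + of_real a)"
proof -
  have "exp (- s * of_real t) * of_real (exp (- (a * t))) = exp (- (s + of_real a) * of_real t)" for t
    by (simp add: exp_of_real[symmetric] exp_add[symmetric] algebra_simps)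
  moreover have "Re (s + of_real a) > 0" using assms by simp
  ultimately show "laplace_integrable (\<lambda>t. exp (- (a * t))) s"
    "laplace (\<lambda>t. exp (- (a * t))) s = 1 / (s + of_real a)"
    unfolding laplace_integrable_def laplace_def
    by (simp_all only: set_integrable_exp_complex set_integral_exp_complex)
qed

lemma has_laplace_exp: "has_laplace (\<lambda>t. exp (- (a * t))) (\<lambda>s. 1 / (s + of_real a))"
  unfolding has_laplace_def using rational_at_infinity_inverse_linear laplace_exp by blast

lemma laplace_of_real: "laplace g (of_real x) \<in> \<real>"
proof -
  have "exp (- of_real x * of_real t) * of_real (g t) = complex_of_real (exp (- x * t) * g t)" for t
    by (simp add: exp_of_real[symmetric])
  then have "laplace g (of_real x) = of_real (LINT t:{0..}|lebesgue. exp (- x * t) * g t)"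
    unfolding laplace_def by (simp only: set_integral_complex_of_real)
  then show ?thesis by simp
qed

text \<open>
  With \<open>h = g - \<alpha>\<close>, the claim is that \<open>x * laplace h x\<close> tends to \<open>0\<close>. Near \<open>0\<close> the function \<open>h\<close> is
  below \<open>\<epsilon> / 2\<close>, and \<open>x * exp (- x * t)\<close> has integral \<open>1\<close>; away from \<open>0\<close> the kernel at \<open>x\<close> is
  smaller than the kernel at a fixed abscissa \<open>a\<close> of convergence by a factor
  \<open>exp (- (x - a) * \<delta>)\<close>, which beats the factor \<open>x\<close>.
\<close>

lemma initial_value_theorem:
  assumes int: "\<And>s. Re s > \<sigma> \<Longrightarrow> laplace_integrable g s"
    and lim: "(g \<longlongrightarrow> \<alpha>) (at_right 0)"
  shows "((\<lambda>x. of_real x * laplace g (of_real x)) \<longlongrightarrow> of_real \<alpha>) at_top"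
proof -
  define a where "a = max \<sigma> 0 + 1"
  define h where "h = (\<lambda>t. g t - \<alpha>)"
  define K where "K = (LINT t:{0..}|lebesgue. exp (- a * t) * \<bar>h t\<bar>)"
  have a: "a > 0" "a > \<sigma>" by (auto simp: a_def)
  have h: "laplace_integrable h x" "laplace h x = laplace g x - \<alpha> / x" if "x \<ge> a" for x :: real
  proof -
    have eq: "exp (- complex_of_real x * of_real t) * of_real (h t) =
      exp (- of_real x * of_real t) * of_real (g t) - of_real \<alpha> * exp (- of_real x * of_real t)" for t
      by (simp add: h_def algebra_simps)
    have "Re (of_real x) > \<sigma>" "Re (complex_of_real x) > 0" using that a by auto
    note int[OF this(1), unfolded laplace_integrable_def]
      set_integrable_mult_right[OF set_integrable_exp_complex[OF this(2)], of "of_real \<alpha>"]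
      set_integral_exp_complex[OF this(2)]
    then show "laplace_integrable h x" "laplace h x = laplace g x - \<alpha> / x"
      unfolding laplace_integrable_def laplace_def eq by (simp_all add: set_integral_diff)
  qed
  have norm_eq: "cmod (exp (- complex_of_real x * of_real t) * of_real (h t)) = exp (- x * t) * \<bar>h t\<bar>" for x t
    by (simp add: norm_mult)
  have hint: "set_integrable lebesgue {0..} (\<lambda>t. exp (- x * t) * \<bar>h t\<bar>)" if "x \<ge> a" for x
    using set_integrable_norm[OF h(1)[OF that, unfolded laplace_integrable_def]] unfolding norm_eq .
  have eint: "set_integrable lebesgue {0..} (\<lambda>t. exp (- x * t))"
    "(LINT t:{0..}|lebesgue. exp (- x * t)) = 1 / x" if "x \<ge> a" for x
  proof -
    have "x > 0" using that a by simp
    note x = has_integral_exp_minus_to_infinity[OF this, of 0]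
    show i: "set_integrable lebesgue {0..} (\<lambda>t. exp (- x * t))"
      using has_integral_integrable[OF x] by (intro nonnegative_absolutely_integrable_1) auto
    show "(LINT t:{0..}|lebesgue. exp (- x * t)) = 1 / x"
      using set_lebesgue_integral_eq_integral(2)[OF i] integral_unique[OF x] by simp
  qed
  show ?thesis
  proof (rule tendstoI)
    fix \<epsilon> :: real assume \<epsilon>: "\<epsilon> > 0"
    have "\<forall>\<^sub>F t in at_right 0. dist (g t) \<alpha> < \<epsilon> / 2" using lim \<epsilon> by (intro tendstoD) auto
    then obtain \<delta> where \<delta>: "\<delta> > 0" "\<And>t. \<lbrakk>0 < t; t < \<delta>\<rbrakk> \<Longrightarrow> \<bar>h t\<bar> < \<epsilon> / 2"
      unfolding eventually_at_right_field h_def dist_real_def by blast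
    define M where "M = (\<lambda>x t. \<epsilon> / 2 * exp (- x * t) + exp (- (x - a) * \<delta>) * (exp (- a * t) * \<bar>h t\<bar>))"
    have pointwise: "exp (- x * t) * \<bar>h t\<bar> \<le> M x t" if "x \<ge> a" "t > 0" for x t
    proof (cases "t < \<delta>")
      case True
      then have "exp (- x * t) * \<bar>h t\<bar> \<le> exp (- x * t) * (\<epsilon> / 2)"
        using \<delta>(2)[of t] that by (intro mult_left_mono) auto
      then show ?thesis unfolding M_def by (smt (verit) exp_ge_zero mult.commute mult_nonneg_nonneg abs_ge_zero)
    next
      case False
      then have "exp (- x * t) \<le> exp (- (x - a) * \<delta>) * exp (- a * t)"
        using that mult_left_mono[of \<delta> t "x - a"] by (simp add: exp_add[symmetric] algebra_simps)
      then have "exp (- x * t) * \<bar>h t\<bar> \<le> exp (- (x - a) * \<delta>) * exp (- a * t) * \<bar>h t\<bar>"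
        by (intro mult_right_mono) auto
      then show ?thesis unfolding M_def using \<epsilon> by (simp add: mult.assoc add_increasing)
    qed
    have bound: "cmod (of_real x * laplace g (of_real x) - of_real \<alpha>) \<le> \<epsilon> / 2 + x * exp (- (x - a) * \<delta>) * K"
      if x: "x \<ge> a" for x
    proof -
      have x0: "x > 0" using x a by simp
      have i1: "set_integrable lebesgue {0..} (\<lambda>t. \<epsilon> / 2 * exp (- x * t))"
        using eint(1)[OF x] by simp
      have i2: "set_integrable lebesgue {0..} (\<lambda>t. exp (- (x - a) * \<delta>) * (exp (- a * t) * \<bar>h t\<bar>))"
        using hint[of a] by simp
      have "cmod (laplace h x) \<le> (LINT t:{0..}|lebesgue. exp (- x * t) * \<bar>h t\<bar>)"
        using set_integral_norm_bound[OF h(1)[OF x, unfolded laplace_integrable_def]]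
        unfolding laplace_def norm_eq .
      also have "\<dots> \<le> (LINT t:{0..}|lebesgue. M x t)"
      proof (rule set_integral_mono_AE)
        show "set_integrable lebesgue {0..} (M x)"
          unfolding M_def using i1 i2 by (rule set_integral_add)
        \<comment> \<open>The value \<open>g 0\<close> is not controlled by the one-sided limit.\<close>
        have "AE t in lebesgue. t \<noteq> (0::real)"
          by (intro AE_completion AE_lborel_singleton)
        then show "AE t \<in> {0..} in lebesgue. exp (- x * t) * \<bar>h t\<bar> \<le> M x t"
          by eventually_elim (use pointwise[OF x] in auto)
      qed (rule hint[OF x])
      also have "\<dots> = \<epsilon> / 2 / x + exp (- (x - a) * \<delta>) * K"
        unfolding M_def set_integral_add(2)[OF i1 i2] K_def
        using eint(2)[OF x] by simp
      finally have "x * cmod (laplace h x) \<le> x * (\<epsilon> / 2 / x + exp (- (x - a) * \<delta>) * K)"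
        using x0 by (intro mult_left_mono) auto
      also have "\<dots> = \<epsilon> / 2 + x * exp (- (x - a) * \<delta>) * K" using x0 by (simp add: distrib_left)
      also have "x * cmod (laplace h x) = cmod (of_real x * laplace h x)" using x0 by (simp add: norm_mult)
      also have "of_real x * laplace h x = of_real x * laplace g (of_real x) - of_real \<alpha>"
        using x0 by (simp add: h(2)[OF x] right_diff_distrib)
      finally show ?thesis .
    qed
    have "((\<lambda>x. \<epsilon> / 2 + x * exp (- (x - a) * \<delta>) * K) \<longlongrightarrow> \<epsilon> / 2) at_top"
      using \<delta>(1) by real_asymp
    from order_tendstoD(2)[OF this, of \<epsilon>] \<epsilon>
    have "\<forall>\<^sub>F x in at_top. \<epsilon> / 2 + x * exp (- (x - a) * \<delta>) * K < \<epsilon>" by simp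
    then show "\<forall>\<^sub>F x in at_top. dist (of_real x * laplace g (of_real x)) (complex_of_real \<alpha>) < \<epsilon>"
      using eventually_ge_at_top[of a]
      by eventually_elim (use bound in \<open>fastforce simp: dist_norm\<close>)
  qed
qed

lemma has_laplace_transform_cong:
  assumes "has_laplace g R" "\<forall>\<^sub>F s in at_infinity. R s = S s"
  shows "has_laplace g S"
proof -
  obtain \<sigma> p q where q: "q \<noteq> 0" and ev: "\<forall>\<^sub>F s in at_infinity. R s = poly p s / poly q s"
    and *: "\<forall>s. Re s > \<sigma> \<longrightarrow> laplace_integrable g s \<and> laplace g s = R s"
    using assms(1) unfolding has_laplace_def rational_at_infinity_def by blast
  obtain B where B: "\<And>s. cmod s \<ge> B \<Longrightarrow> R s = S s"
    using assms(2) unfolding eventually_at_infinity by blast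
  have "laplace_integrable g s \<and> laplace g s = S s" if "Re s > max \<sigma> B" for s
  proof -
    have "cmod s \<ge> B" using that complex_Re_le_cmod[of s] by simp
    then show ?thesis using * B that by simp
  qed
  moreover have "\<forall>\<^sub>F s in at_infinity. S s = poly p s / poly q s"
    using ev assms(2) by eventually_elim simp
  ultimately show ?thesis
    using q unfolding has_laplace_def rational_at_infinity_def by blast
qed

lemma tendsto_at_infinity_imp_along_reals:
  assumes "(F \<longlongrightarrow> c) (at_infinity :: complex filter)"
  shows "((\<lambda>x. F (of_real x)) \<longlongrightarrow> c) at_top"
proof -
  have "filterlim (\<lambda>x. complex_of_real x) at_infinity at_top"
    by (rule filterlim_of_real_at_infinity)
  with assms show ?thesis by (rule filterlim_compose)
qed

text \<open>
  Rationality turns the limit along the positive reals into a limit at complex infinity.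
\<close>

lemma has_laplace_initial_value:
  assumes "has_laplace g G" "zero_at_infinity_ge 1 G" "(g \<longlongrightarrow> \<alpha>) (at_right 0)"
  shows "((\<lambda>s. s * G s) \<longlongrightarrow> of_real \<alpha>) at_infinity"
proof -
  obtain \<sigma> where \<sigma>: "\<And>s. Re s > \<sigma> \<Longrightarrow> laplace_integrable g s \<and> laplace g s = G s"
    and rat: "rational_at_infinity G"
    using assms(1) unfolding has_laplace_def by blast
  obtain c where c: "((\<lambda>s. s * G s) \<longlongrightarrow> c) at_infinity"
    using rational_leading_coefficient[OF rat assms(2)] by auto
  have "((\<lambda>x. of_real x * laplace g (of_real x)) \<longlongrightarrow> of_real \<alpha>) at_top"
    using \<sigma> assms(3) by (intro initial_value_theorem[of \<sigma>]) auto
  moreover have "\<forall>\<^sub>F x in at_top. of_real x * laplace g (of_real x) = of_real x * G (of_real x)"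
    using eventually_gt_at_top[of \<sigma>] by eventually_elim (simp add: \<sigma>)
  ultimately have "((\<lambda>x. of_real x * G (of_real x)) \<longlongrightarrow> of_real \<alpha>) at_top"
    by (rule Lim_transform_eventually)
  from tendsto_unique[OF _ tendsto_at_infinity_imp_along_reals[OF c] this] c show ?thesis by simp
qed

text \<open>
  The transforms of real functions are real on the real axis, hence so are their expansion
  coefficients at infinity. A complex coefficient could not be matched by a real function.
\<close>

lemma has_laplace_coefficient_real:
  assumes "has_laplace f F" "has_laplace g G"
    and lim: "((\<lambda>s. s ^ k * (F s - G s)) \<longlongrightarrow> c) at_infinity"
  shows "c \<in> \<real>"
proof (rule Lim_in_closed_set)
  show "((\<lambda>x. of_real x ^ k * (F (of_real x) - G (of_real x))) \<longlongrightarrow> c) at_top"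
    using lim by (rule tendsto_at_infinity_imp_along_reals)
  obtain \<sigma> \<tau> where *: "\<And>s. Re s > \<sigma> \<Longrightarrow> laplace f s = F s" "\<And>s. Re s > \<tau> \<Longrightarrow> laplace g s = G s"
    using assms(1,2) unfolding has_laplace_def by blast
  show "\<forall>\<^sub>F x in at_top. of_real x ^ k * (F (of_real x) - G (of_real x)) \<in> \<real>"
    using eventually_gt_at_top[of \<sigma>] eventually_gt_at_top[of \<tau>]
  proof eventually_elim
    case (elim x)
    then have "F (of_real x) = laplace f (of_real x)" "G (of_real x) = laplace g (of_real x)"
      using * by simp_all
    then show ?case by (simp add: laplace_of_real)
  qed
qed (simp_all add: closed_complex_Reals)

section \<open>A family of exponential polynomials with explicit transforms\<close>

text \<open>
  In the variable \<open>x = exp (- t)\<close> these are the unnormalised Bernstein polynomials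
  \<open>x ^ k * (1 - x) ^ n\<close>. They vanish to order \<open>n\<close> at \<open>t = 0\<close>, so that their transforms vanish to
  order exactly \<open>n + 1\<close> at infinity.
\<close>

definition bump :: "nat \<Rightarrow> nat \<Rightarrow> real \<Rightarrow> real" where
  "bump k n t = exp (- t) ^ k * (1 - exp (- t)) ^ n"

definition bump_transform :: "nat \<Rightarrow> nat \<Rightarrow> complex \<Rightarrow> complex" where
  "bump_transform k n s = fact n / (\<Prod>j\<le>n. s + of_nat (k + j))"

text \<open>
  The recurrence \<open>bump k (Suc n) = bump k n - bump (Suc k) n\<close> reduces everything to pure
  exponentials, and the products telescope: the two denominators share all factors but the first
  and the last one.
\<close>

lemma has_laplace_bump: "has_laplace (bump k n) (bump_transform k n)"
proof (induction n arbitrary: k)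
  case 0
  have "bump k 0 = (\<lambda>t. exp (- (real k * t)))"
    by (simp add: bump_def fun_eq_iff flip: exp_of_nat_mult)
  moreover have "bump_transform k 0 = (\<lambda>s. 1 / (s + of_real (real k)))"
    by (simp add: bump_transform_def fun_eq_iff)
  ultimately show ?case using has_laplace_exp[of "real k"] by simp
next
  case (Suc n)
  have "(\<lambda>t. bump k n t + (- 1) * bump (Suc k) n t) = bump k (Suc n)"
    by (simp add: bump_def fun_eq_iff algebra_simps)
  then have "has_laplace (bump k (Suc n)) (\<lambda>s. bump_transform k n s + of_real (- 1) * bump_transform (Suc k) n s)"
    using has_laplace_add[OF Suc has_laplace_cmult[OF Suc, of "-1"]] by metis
  moreover have "\<forall>\<^sub>F s in at_infinity. bump_transform k n s + of_real (- 1) * bump_transform (Suc k) n s =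
      bump_transform k (Suc n) s"
  proof (rule eventually_at_infinityI[of "real (k + n + 2)"])
    fix s :: complex assume s: "real (k + n + 2) \<le> cmod s"
    have nz: "s + of_nat m \<noteq> 0" if "m \<le> k + n + 1" for m
    proof
      assume "s + of_nat m = 0"
      then have "cmod s = m" by (metis add_eq_0_iff2 norm_minus_cancel norm_of_nat)
      with s that show False by simp
    qed
    define A where "A = (\<Prod>j\<le>n. s + of_nat (k + j))"
    define B where "B = (\<Prod>j\<le>n. s + of_nat (Suc k + j))"
    have AB: "A \<noteq> 0" "B \<noteq> 0" unfolding A_def B_def by (auto simp: nz simp del: of_nat_add of_nat_Suc add_Suc)
    have prod1: "(\<Prod>j\<le>Suc n. s + of_nat (k + j)) = A * (s + of_nat (k + n + 1))"
      by (simp add: A_def)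
    have prod2: "(\<Prod>j\<le>Suc n. s + of_nat (k + j)) = (s + of_nat k) * B"
      by (simp add: B_def prod.atMost_Suc_shift add_ac del: prod.atMost_Suc)
    have n1: "s + of_nat (k + n + 1) \<noteq> 0" "s + of_nat k \<noteq> 0" by (rule nz; simp)+
    have "fact n / A = fact n * (s + of_nat (k + n + 1)) / (A * (s + of_nat (k + n + 1)))"
      using n1 by (simp del: of_nat_add)
    moreover have "fact n / B = fact n * (s + of_nat k) / ((s + of_nat k) * B)"
      using n1 by (simp del: of_nat_add)
    ultimately have "fact n / A - fact n / B =
        (fact n * (s + of_nat (k + n + 1)) - fact n * (s + of_nat k)) / (A * (s + of_nat (k + n + 1)))"
      unfolding prod1[symmetric] prod2[symmetric] by (simp only: diff_divide_distrib)
    also have "fact n * (s + of_nat (k + n + 1)) - fact n * (s + of_nat k) = fact (Suc n)"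
      by (simp add: algebra_simps)
    finally show "bump_transform k n s + of_real (- 1) * bump_transform (Suc k) n s = bump_transform k (Suc n) s"
      unfolding bump_transform_def prod1 by (simp add: A_def B_def)
  qed
  ultimately show ?case by (rule has_laplace_transform_cong)
qed

lemma bump_transform_leading_coefficient:
  "((\<lambda>s. s ^ Suc n * bump_transform k n s) \<longlongrightarrow> fact n) at_infinity"
proof -
  have lim: "((\<lambda>s. s / (s + c)) \<longlongrightarrow> 1) at_infinity" for c :: complex
  proof -
    have "filterlim (\<lambda>s. s + c) at_infinity at_infinity"
      using tendsto_add_filterlim_at_infinity'[OF filterlim_ident tendsto_const] .
    then have "((\<lambda>s. inverse (s + c)) \<longlongrightarrow> 0) at_infinity"
      by (rule filterlim_compose[OF tendsto_inverse_0])
    then have "((\<lambda>s. 1 - c * inverse (s + c)) \<longlongrightarrow> 1 - c * 0) at_infinity"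
      by (intro tendsto_intros)
    moreover have "\<forall>\<^sub>F s in at_infinity. 1 - c * inverse (s + c) = s / (s + c)"
    proof (rule eventually_at_infinityI[of "cmod c + 1"])
      fix s assume "cmod c + 1 \<le> cmod s"
      then have "s + c \<noteq> 0" by (auto simp: add_eq_0_iff2)
      then show "1 - c * inverse (s + c) = s / (s + c)" by (simp add: field_simps)
    qed
    ultimately show ?thesis by (auto intro: Lim_transform_eventually)
  qed
  have "((\<lambda>s::complex. fact n * (\<Prod>j\<le>n. s / (s + of_nat (k + j)))) \<longlongrightarrow> fact n * (\<Prod>j\<le>n. 1)) at_infinity"
    by (rule tendsto_mult[OF tendsto_const tendsto_prod]) (rule lim)
  then show ?thesis by (simp add: bump_transform_def prod_dividef mult.commute)
qed

lemma bump_nonneg: "t \<ge> 0 \<Longrightarrow> 0 \<le> bump k n t"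
  by (simp add: bump_def)

lemma bump_le_1: "t \<ge> 0 \<Longrightarrow> bump k n t \<le> 1"
  unfolding bump_def by (intro mult_le_one power_le_one) auto

text \<open>
  With \<open>x = exp (- t)\<close>, the geometric sum \<open>(1 - x) * (1 + x + \<dots> + x ^ k) = 1 - x ^ Suc k\<close> is at
  most \<open>1\<close>, and each of its \<open>Suc k\<close> summands is at least \<open>(1 - x) * x ^ k\<close>. So a bump with a zero at
  \<open>t = 0\<close> becomes uniformly small as \<open>k\<close> grows, although the leading coefficient of its transform
  does not depend on \<open>k\<close>.
\<close>

lemma bump_Suc_le:
  assumes "t \<ge> 0"
  shows "bump k (Suc n) t \<le> 1 / real (Suc k)"
proof -
  define x where "x = exp (- t)"
  have x: "0 \<le> x" "x \<le> 1" using assms by (auto simp: x_def)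
  have "real (Suc k) * x ^ k = (\<Sum>i<Suc k. x ^ k)" by simp
  also have "\<dots> \<le> (\<Sum>i<Suc k. x ^ i)"
    using x by (intro sum_mono power_decreasing) auto
  finally have "real (Suc k) * x ^ k * (1 - x) \<le> (\<Sum>i<Suc k. x ^ i) * (1 - x)"
    using x by (intro mult_right_mono) auto
  also have "\<dots> = 1 - x ^ Suc k" using one_diff_power_eq[of x "Suc k"] by (simp only: mult.commute)
  also have "\<dots> \<le> 1" using x by simp
  finally have *: "x ^ k * (1 - x) \<le> 1 / real (Suc k)" by (simp add: field_simps)
  have "bump k (Suc n) t = x ^ k * (1 - x) * (1 - x) ^ n"
    by (simp add: bump_def x_def)
  also have "\<dots> \<le> x ^ k * (1 - x) * 1"
    using x by (intro mult_left_mono power_le_one) auto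
  finally show ?thesis using * by simp
qed

lemma continuous_on_bump: "continuous_on S (bump k n)"
  unfolding bump_def by (intro continuous_intros)

lemma bump_tendsto_0:
  assumes "k \<ge> 1"
  shows "(bump k n \<longlongrightarrow> 0) at_top"
proof -
  have "((\<lambda>t::real. exp (- t)) \<longlongrightarrow> 0) at_top" by real_asymp
  then have "((\<lambda>t. exp (- t) ^ k * (1 - exp (- t)) ^ n) \<longlongrightarrow> 0 ^ k * (1 - 0 :: real) ^ n) at_top"
    by (intro tendsto_intros)
  then show ?thesis using assms unfolding bump_def by (simp add: power_0_left)
qed

section \<open>Uniform approximation with prescribed behaviour at infinity\<close>

lemma restrict_in_C0:
  assumes "continuous_on {0..} f" "(f \<longlongrightarrow> 0) at_top"
  shows "restrict f {0..} \<in> C0"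
proof -
  have "continuous_on {0..} (restrict f {0..})"
    using assms(1) by (subst continuous_on_cong[OF refl, of _ _ f]) auto
  moreover have "\<forall>\<^sub>F t in at_top. f t = restrict f {0..} t"
    using eventually_ge_at_top[of 0] by eventually_elim simp
  with assms(2) have "(restrict f {0..} \<longlongrightarrow> 0) at_top" by (rule Lim_transform_eventually)
  ultimately show ?thesis unfolding C0_def by simp
qed

lemma C0_tendsto_at_right: "e \<in> C0 \<Longrightarrow> (e \<longlongrightarrow> e 0) (at_right 0)"
  unfolding C0_def continuous_on_def
  by (auto intro: tendsto_within_subset)

text \<open>
  The substitution \<open>x = exp (- t)\<close> turns \<open>\<phi>\<close> into a continuous function \<open>\<psi>\<close> on the unit interval
  with \<open>\<psi> 0 = 0\<close>. The terms of its Bernstein polynomials are multiples of bumps, and the term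
  \<open>k = 0\<close>, whose bump would not decay, carries the coefficient \<open>\<psi> 0\<close> and drops out.
\<close>

lemma C0_approximation_by_bumps:
  assumes \<phi>: "\<phi> \<in> C0" and \<epsilon>: "\<epsilon> > 0"
  obtains e E where "e \<in> C0" "has_laplace e E" "zero_at_infinity_ge 1 E"
    "\<And>t. t \<ge> 0 \<Longrightarrow> \<bar>\<phi> t - e t\<bar> < \<epsilon>"
proof -
  define \<psi> where "\<psi> = (\<lambda>x::real. if x \<le> 0 then 0 else \<phi> (- ln x))"
  have \<phi>c: "continuous_on {0..} \<phi>" and \<phi>l: "(\<phi> \<longlongrightarrow> 0) at_top"
    using \<phi> by (auto simp: C0_def)
  have "continuous_on {0..1} \<psi>"
    unfolding continuous_on_def
  proof
    fix x :: real assume x: "x \<in> {0..1}"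
    show "(\<psi> \<longlongrightarrow> \<psi> x) (at x within {0..1})"
    proof (cases "x = 0")
      case True
      have "filterlim (\<lambda>x::real. - ln x) at_top (at_right 0)" by real_asymp
      then have "((\<lambda>x. \<phi> (- ln x)) \<longlongrightarrow> 0) (at_right 0)"
        by (rule filterlim_compose[OF \<phi>l])
      moreover have "\<forall>\<^sub>F x in at_right 0. \<phi> (- ln x) = \<psi> x"
        by (auto simp: \<psi>_def eventually_at_filter)
      ultimately have "(\<psi> \<longlongrightarrow> 0) (at_right 0)" by (rule Lim_transform_eventually)
      moreover have "at 0 within {0..1} \<le> at_right (0::real)"
        unfolding at_within_def by (rule inf_mono) auto
      ultimately show ?thesis using True by (auto simp: \<psi>_def intro: tendsto_mono)
    next
      case False
      have "continuous_on {0<..1} (\<lambda>x. \<phi> (- ln x))"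
        by (intro continuous_on_compose2[OF \<phi>c] continuous_intros) auto
      moreover have "continuous_on {0<..1} (\<lambda>x. \<phi> (- ln x)) \<longleftrightarrow> continuous_on {0<..1} \<psi>"
        by (intro continuous_on_cong) (auto simp: \<psi>_def)
      ultimately have "(\<psi> \<longlongrightarrow> \<psi> x) (at x within {0<..1})"
        using x False by (auto simp: continuous_on_def)
      moreover have "at x within {0<..1} = at x within {0..1}"
        using x False by (intro at_within_nhd[of x "{0<..}"]) auto
      ultimately show ?thesis by simp
    qed
  qed
  then obtain n where n: "\<And>x. x \<in> {0..1} \<Longrightarrow> \<bar>\<psi> x - (\<Sum>k\<le>n. \<psi> (k / n) * Bernstein n k x)\<bar> < \<epsilon>"
    using Bernstein_Weierstrass[OF _ \<epsilon>] by blast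
  define c where "c = (\<lambda>k. \<psi> (real k / real n) * real (n choose k))"
  define f where "f = (\<lambda>t. \<Sum>k=1..n. c k * bump k (n - k) t)"
  define E where "E = (\<lambda>s. \<Sum>k=1..n. of_real (c k) * bump_transform k (n - k) s)"
  have f: "has_laplace f E" unfolding f_def E_def
    by (intro has_laplace_sum has_laplace_cmult has_laplace_bump) auto
  have "((\<lambda>t. \<Sum>k=1..n. c k * bump k (n - k) t) \<longlongrightarrow> (\<Sum>k=1..n. c k * 0)) at_top"
    by (intro tendsto_intros bump_tendsto_0) auto
  moreover have "continuous_on {0..} f"
    unfolding f_def by (intro continuous_intros continuous_on_bump)
  ultimately have "restrict f {0..} \<in> C0"
    by (intro restrict_in_C0) (auto simp: f_def)
  moreover have "has_laplace (restrict f {0..}) E"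
    using f by (subst has_laplace_cong[of _ f]) auto
  moreover have "zero_at_infinity_ge 1 (bump_transform k m)" for k m
    using tendsto_imp_zero_at_infinity_ge[OF bump_transform_leading_coefficient]
    by (rule zero_at_infinity_ge_mono) simp
  then have "zero_at_infinity_ge 1 E"
    unfolding E_def zero_at_infinity_ge_def by (intro big_sum_in_bigo) auto
  moreover have "\<bar>\<phi> t - restrict f {0..} t\<bar> < \<epsilon>" if t: "t \<ge> 0" for t
  proof -
    have "(\<Sum>k\<le>n. \<psi> (k / n) * Bernstein n k (exp (- t))) = (\<Sum>k=1..n. \<psi> (k / n) * Bernstein n k (exp (- t)))"
    proof (rule sum.mono_neutral_right)
      show "\<forall>k\<in>{..n} - {1..n}. \<psi> (k / n) * Bernstein n k (exp (- t)) = 0"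
        by (auto simp: \<psi>_def not_less_eq_eq)
    qed auto
    also have "\<dots> = f t" unfolding f_def
      by (intro sum.cong) (auto simp: c_def bump_def Bernstein_def)
    finally show ?thesis using n[of "exp (- t)"] t by (simp add: \<psi>_def)
  qed
  ultimately show thesis by (rule that)
qed

text \<open>
  Adding a multiple of one bump removes the coefficient of order \<open>Suc n\<close> from the difference of
  the transforms. The parameter \<open>M\<close> is left free, as it controls the size of the correction.
\<close>

lemma correct_coefficient:
  assumes e: "e \<in> C0" "has_laplace e E" and W: "rational_at_infinity W"
    and lim: "((\<lambda>s. s ^ Suc n * (W s - E s)) \<longlongrightarrow> of_real d) at_infinity"
    and M: "M \<ge> 1"
  obtains e' E' where "e' \<in> C0" "has_laplace e' E'" "zero_at_infinity_ge (Suc (Suc n)) (\<lambda>s. W s - E' s)"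
    "\<And>t. t \<ge> 0 \<Longrightarrow> e' t = e t + d / fact n * bump M n t"
proof
  let ?f = "\<lambda>t. e t + d / fact n * bump M n t"
  let ?E = "\<lambda>s. E s + of_real (d / fact n) * bump_transform M n s"
  have "continuous_on {0..} ?f"
    using e(1) by (intro continuous_intros continuous_on_bump) (simp add: C0_def)
  moreover have "(?f \<longlongrightarrow> 0 + d / fact n * 0) at_top"
    using e(1) by (intro tendsto_intros bump_tendsto_0 M) (simp add: C0_def)
  ultimately show "restrict ?f {0..} \<in> C0" by (intro restrict_in_C0) auto
  have E': "has_laplace ?f ?E" by (intro has_laplace_add has_laplace_cmult e has_laplace_bump)
  then show "has_laplace (restrict ?f {0..}) ?E"
    by (subst has_laplace_cong[of _ ?f]) auto
  show "restrict ?f {0..} t = ?f t" if "t \<ge> 0" for t using that by simp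
  have "((\<lambda>s. s ^ Suc n * (W s - E s) - of_real (d / fact n) * (s ^ Suc n * bump_transform M n s))
      \<longlongrightarrow> of_real d - of_real (d / fact n) * fact n) at_infinity"
    by (intro tendsto_diff tendsto_mult tendsto_const lim bump_transform_leading_coefficient)
  moreover have "of_real d - of_real (d / fact n) * fact n = (0 :: complex)"
    by simp
  ultimately have "((\<lambda>s. s ^ Suc n * (W s - ?E s)) \<longlongrightarrow> 0) at_infinity"
    by (simp add: algebra_simps)
  then show "zero_at_infinity_ge (Suc (Suc n)) (\<lambda>s. W s - ?E s)"
    using W E' unfolding has_laplace_def
    by (intro rational_zero_at_infinity_Suc rational_at_infinity_diff) auto
qed

text \<open>
  Induction on the number of matched coefficients. The first coefficient is the initial value, so
  matching it costs no more than the distance already present at \<open>t = 0\<close>. Each later correction uses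
  a bump with a zero at \<open>t = 0\<close>, which costs arbitrarily little once its parameter \<open>M\<close> is large.
\<close>

lemma approximate_with_coefficients:
  assumes \<phi>: "\<phi> \<in> C0" and w: "has_laplace w W"
    and W: "((\<lambda>s. s * W s) \<longlongrightarrow> of_real (\<phi> 0)) at_infinity"
    and \<epsilon>: "\<epsilon> > 0"
  shows "\<exists>e E. e \<in> C0 \<and> has_laplace e E \<and> zero_at_infinity_ge (Suc (Suc k)) (\<lambda>s. W s - E s) \<and>
     (\<forall>t\<ge>0. \<bar>\<phi> t - e t\<bar> < \<epsilon>)"
  using \<epsilon>
proof (induction k arbitrary: \<epsilon>)
  case 0
  have rat: "rational_at_infinity W" using w unfolding has_laplace_def by blast
  obtain e E where e: "e \<in> C0" "has_laplace e E" and E: "zero_at_infinity_ge 1 E"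
    and close: "\<And>t. t \<ge> 0 \<Longrightarrow> \<bar>\<phi> t - e t\<bar> < \<epsilon> / 2"
    using C0_approximation_by_bumps[OF \<phi>, of "\<epsilon> / 2"] 0 by auto
  define d where "d = \<phi> 0 - e 0"
  have "((\<lambda>s. s * E s) \<longlongrightarrow> of_real (e 0)) at_infinity"
    by (intro has_laplace_initial_value[OF e(2) E] C0_tendsto_at_right e)
  with W have "((\<lambda>s. s * W s - s * E s) \<longlongrightarrow> of_real (\<phi> 0) - of_real (e 0)) at_infinity"
    by (rule tendsto_diff)
  then have "((\<lambda>s. s ^ Suc 0 * (W s - E s)) \<longlongrightarrow> of_real d) at_infinity"
    by (simp add: d_def algebra_simps)
  from correct_coefficient[OF e rat this, of 1] obtain e' E' where
    e': "e' \<in> C0" "has_laplace e' E'" "zero_at_infinity_ge (Suc (Suc 0)) (\<lambda>s. W s - E' s)"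
      "\<And>t. t \<ge> 0 \<Longrightarrow> e' t = e t + d * bump 1 0 t"
    by auto
  have "\<bar>\<phi> t - e' t\<bar> < \<epsilon>" if t: "t \<ge> 0" for t
  proof -
    have "\<bar>d * bump 1 0 t\<bar> \<le> \<bar>d\<bar> * 1"
      unfolding abs_mult using bump_nonneg[OF t] bump_le_1[OF t] by (intro mult_left_mono) auto
    moreover have "\<bar>d\<bar> < \<epsilon> / 2" unfolding d_def using close[of 0] by simp
    ultimately show ?thesis using close[OF t] e'(4)[OF t] by linarith
  qed
  with e' show ?case by blast
next
  case (Suc k)
  have rat: "rational_at_infinity W" using w unfolding has_laplace_def by blast
  have "\<epsilon> / 2 > 0" using Suc.prems by simp
  from Suc.IH[OF this] obtain e E where e: "e \<in> C0" "has_laplace e E"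
    and E: "zero_at_infinity_ge (Suc (Suc k)) (\<lambda>s. W s - E s)"
    and close: "\<And>t. t \<ge> 0 \<Longrightarrow> \<bar>\<phi> t - e t\<bar> < \<epsilon> / 2"
    by blast
  have "rational_at_infinity (\<lambda>s. W s - E s)"
    using rat e(2) unfolding has_laplace_def by (blast intro: rational_at_infinity_diff)
  from rational_leading_coefficient[OF this E] obtain c where
    c: "((\<lambda>s. s ^ Suc (Suc k) * (W s - E s)) \<longlongrightarrow> c) at_infinity" by blast
  obtain d where d: "c = of_real d"
    using has_laplace_coefficient_real[OF w e(2) c] by (auto elim: Reals_cases)
  \<comment> \<open>By \<open>bump_Suc_le\<close> this \<open>M\<close> makes the correction at most \<open>\<epsilon> / 2\<close>.\<close>
  obtain M :: nat where M: "2 * \<bar>d\<bar> / \<epsilon> < real M" using reals_Archimedean2 by blast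
  from correct_coefficient[OF e rat c[unfolded d], of "Suc M"] obtain e' E' where
    e': "e' \<in> C0" "has_laplace e' E'" "zero_at_infinity_ge (Suc (Suc (Suc k))) (\<lambda>s. W s - E' s)"
      "\<And>t. t \<ge> 0 \<Longrightarrow> e' t = e t + d / fact (Suc k) * bump (Suc M) (Suc k) t"
    by (metis le_add1 plus_1_eq_Suc)
  have "\<bar>\<phi> t - e' t\<bar> < \<epsilon>" if t: "t \<ge> 0" for t
  proof -
    have "\<bar>d / fact (Suc k)\<bar> \<le> \<bar>d\<bar> / 1"
      unfolding abs_divide by (intro divide_left_mono) (auto simp: fact_ge_1 simp del: fact_Suc)
    then have "\<bar>d / fact (Suc k) * bump (Suc M) (Suc k) t\<bar> \<le> \<bar>d\<bar> * (1 / real (Suc (Suc M)))"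
      unfolding abs_mult using bump_nonneg[OF t] bump_Suc_le[OF t]
      by (intro mult_mono) (auto simp del: fact_Suc of_nat_Suc)
    also have "\<dots> \<le> \<epsilon> / 2" using M Suc.prems by (simp add: field_simps)
    finally show ?thesis using close[OF t] e'(4)[OF t] by linarith
  qed
  with e' show ?case by blast
qed

section \<open>The closure in the supremum metric\<close>

text \<open>
  The strict pointwise bound is weaker than the bound on the supremum for a given \<open>\<epsilon>\<close>; the
  quantification over all \<open>\<epsilon>\<close> absorbs the difference.
\<close>

lemma in_closure_of_C0_iff:
  assumes "S \<subseteq> C0"
  shows "\<phi> \<in> mtopology_of C0_metric closure_of S \<longleftrightarrow>
    \<phi> \<in> C0 \<and> (\<forall>\<epsilon>>0. \<exists>e\<in>S. \<forall>t\<ge>0. \<bar>\<phi> t - e t\<bar> < \<epsilon>)"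
proof -
  have "\<phi> \<in> mtopology_of C0_metric closure_of S \<longleftrightarrow>
      \<phi> \<in> C0 \<and> (\<forall>\<epsilon>>0. \<exists>e\<in>S. mdist C0_metric \<phi> e < \<epsilon>)"
    using assms
    unfolding mtopology_of_def Metric_space.metric_closure_of[OF Metric_space_mspace_mdist]
      Metric_space.in_mball[OF Metric_space_mspace_mdist]
    unfolding mspace_C0 by blast
  moreover have "\<bar>\<phi> t - e t\<bar> < \<epsilon>" if "mdist C0_metric \<phi> e < \<epsilon>" "\<phi> \<in> C0" "e \<in> S" "t \<ge> 0" for e t \<epsilon>
  proof -
    have "bounded (\<phi> ` {0..})" "bounded (e ` {0..})"
      using C0_bounded that assms by auto
    then obtain A B where "\<And>t. t \<ge> 0 \<Longrightarrow> \<bar>\<phi> t\<bar> \<le> A" "\<And>t. t \<ge> 0 \<Longrightarrow> \<bar>e t\<bar> \<le> B"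
      unfolding bounded_iff by auto
    then have "\<bar>\<phi> t - e t\<bar> \<le> A + B" if "t \<ge> 0" for t
      using that by (smt (verit))
    then have "bdd_above ((\<lambda>t. \<bar>\<phi> t - e t\<bar>) ` {0..})" by (auto intro!: bdd_aboveI)
    then have "\<bar>\<phi> t - e t\<bar> \<le> (SUP t\<in>{0..}. \<bar>\<phi> t - e t\<bar>)"
      using that by (intro cSUP_upper) auto
    also have "\<dots> < \<epsilon>" using that assms by (auto simp: mdist_C0[symmetric])
    finally show ?thesis .
  qed
  moreover have "mdist C0_metric \<phi> e < \<epsilon>"
    if "\<forall>t\<ge>0. \<bar>\<phi> t - e t\<bar> < \<epsilon> / 2" "\<epsilon> > 0" "\<phi> \<in> C0" "e \<in> S" for e \<epsilon>
  proof -
    have "(SUP t\<in>{0..}. \<bar>\<phi> t - e t\<bar>) \<le> \<epsilon> / 2"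
      using that by (intro cSUP_least) (auto intro: less_imp_le)
    then show ?thesis using that assms by (subst mdist_C0) auto
  qed
  ultimately show ?thesis by (meson half_gt_zero)
qed

lemma X_setI:
  assumes "e \<in> C0" "has_laplace e E" "zero_at_infinity_ge \<theta>\<^sub>w E"
    "zero_at_infinity_ge (\<theta>\<^sub>p + \<theta>\<^sub>w) (\<lambda>s. E s - W s)"
  shows "e \<in> X_set W \<theta>\<^sub>w \<theta>\<^sub>p"
proof -
  obtain T where T: "has_rational_laplace e T" "\<forall>\<^sub>F s in at_infinity. T s = E s"
    using assms(2) by (rule has_laplace_imp_has_rational_laplace)
  have ev: "\<forall>\<^sub>F s in at_infinity. T s - W s = E s - W s"
    using T(2) by eventually_elim simp
  have "zero_at_infinity_ge (\<theta>\<^sub>p + \<theta>\<^sub>w) (\<lambda>s. T s - W s)"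
    using assms(4) zero_at_infinity_ge_cong[OF ev] by blast
  moreover have "zero_at_infinity_ge \<theta>\<^sub>w T"
    using assms(3) zero_at_infinity_ge_cong[OF T(2)] by blast
  ultimately show ?thesis unfolding X_set_def using assms(1) T(1) by blast
qed

text \<open>
  If at least two orders are prescribed, the transforms of \<open>e\<close> and of the weight have the same
  coefficient of \<open>1 / s\<close>, and this coefficient of the transform of \<open>e\<close> is \<open>e 0\<close>.
\<close>

lemma X_set_initial_value:
  assumes e: "e \<in> X_set W \<theta>\<^sub>w \<theta>\<^sub>p" and \<theta>: "\<theta>\<^sub>w \<ge> 1" "\<theta>\<^sub>p + \<theta>\<^sub>w \<ge> 2"
    and W: "((\<lambda>s. s * W s) \<longlongrightarrow> of_real \<alpha>) at_infinity"
  shows "e 0 = \<alpha>"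
proof -
  obtain E where E: "e \<in> C0" "has_laplace e E" "zero_at_infinity_ge \<theta>\<^sub>w E"
    "zero_at_infinity_ge (\<theta>\<^sub>p + \<theta>\<^sub>w) (\<lambda>s. E s - W s)"
    using e has_rational_laplace_imp_has_laplace unfolding X_set_def by blast
  have "zero_at_infinity_ge (Suc 1) (\<lambda>s. E s - W s)"
    using E(4) by (rule zero_at_infinity_ge_mono) (use \<theta> in simp)
  then have "((\<lambda>s. s ^ 1 * (E s - W s)) \<longlongrightarrow> 0) at_infinity"
    by (rule zero_at_infinity_ge_Suc_imp_tendsto_0)
  from tendsto_add[OF this W] have "((\<lambda>s. s * E s) \<longlongrightarrow> of_real \<alpha>) at_infinity"
    by (simp add: algebra_simps)
  moreover have "((\<lambda>s. s * E s) \<longlongrightarrow> of_real (e 0)) at_infinity"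
    using E \<theta> by (intro has_laplace_initial_value[OF E(2)] C0_tendsto_at_right)
      (auto intro: zero_at_infinity_ge_mono)
  ultimately have "complex_of_real \<alpha> = of_real (e 0)"
    using tendsto_unique trivial_limit_at_infinity by blast
  then show ?thesis by simp
qed

text \<open>
  Point evaluation at \<open>0\<close> is continuous for the supremum metric, so the prescribed initial value
  survives in the closure. All further coefficients impose nothing in the limit, by
  \<open>approximate_with_coefficients\<close>.
\<close>

lemma closure_X_set_eq_C0_at:
  assumes w: "has_laplace w W" "zero_at_infinity_ge \<theta>\<^sub>w W" and \<theta>: "\<theta>\<^sub>w \<ge> 1" "\<theta>\<^sub>p + \<theta>\<^sub>w \<ge> 2"
    and W: "((\<lambda>s. s * W s) \<longlongrightarrow> of_real \<alpha>) at_infinity"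
  shows "mtopology_of C0_metric closure_of X_set W \<theta>\<^sub>w \<theta>\<^sub>p = C0_at \<alpha>"
proof -
  have sub: "X_set W \<theta>\<^sub>w \<theta>\<^sub>p \<subseteq> C0" by (auto simp: X_set_def)
  show ?thesis
  proof (intro equalityI subsetI)
    fix \<phi> assume "\<phi> \<in> mtopology_of C0_metric closure_of X_set W \<theta>\<^sub>w \<theta>\<^sub>p"
    then have \<phi>: "\<phi> \<in> C0" "\<And>\<epsilon>. \<epsilon> > 0 \<Longrightarrow> \<exists>e\<in>X_set W \<theta>\<^sub>w \<theta>\<^sub>p. \<forall>t\<ge>0. \<bar>\<phi> t - e t\<bar> < \<epsilon>"
      unfolding in_closure_of_C0_iff[OF sub] by auto
    have "\<bar>\<phi> 0 - \<alpha>\<bar> < \<epsilon>" if "\<epsilon> > 0" for \<epsilon>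
      using \<phi>(2)[OF that] X_set_initial_value[OF _ \<theta> W] by force
    then have "\<bar>\<phi> 0 - \<alpha>\<bar> \<le> 0" by (meson less_irrefl not_le)
    then show "\<phi> \<in> C0_at \<alpha>" using \<phi>(1) by (simp add: C0_at_def)
  next
    fix \<phi> assume "\<phi> \<in> C0_at \<alpha>"
    then have \<phi>: "\<phi> \<in> C0" "\<phi> 0 = \<alpha>" by (auto simp: C0_at_def)
    have "\<exists>e\<in>X_set W \<theta>\<^sub>w \<theta>\<^sub>p. \<forall>t\<ge>0. \<bar>\<phi> t - e t\<bar> < \<epsilon>" if \<epsilon>: "\<epsilon> > 0" for \<epsilon>
    proof -
      obtain e E where e: "e \<in> C0" "has_laplace e E" "\<forall>t\<ge>0. \<bar>\<phi> t - e t\<bar> < \<epsilon>"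
        and E: "zero_at_infinity_ge (Suc (Suc (\<theta>\<^sub>p + \<theta>\<^sub>w - 2))) (\<lambda>s. W s - E s)"
        using approximate_with_coefficients[OF \<phi>(1) w(1) _ \<epsilon>] W unfolding \<phi>(2) by blast
      have "Suc (Suc (\<theta>\<^sub>p + \<theta>\<^sub>w - 2)) = \<theta>\<^sub>p + \<theta>\<^sub>w" using \<theta> by simp
      with E have "zero_at_infinity_ge (\<theta>\<^sub>p + \<theta>\<^sub>w) (\<lambda>s. - (W s - E s))"
        unfolding zero_at_infinity_ge_def by (simp only: landau_o.big.uminus_in_iff)
      then have E': "zero_at_infinity_ge (\<theta>\<^sub>p + \<theta>\<^sub>w) (\<lambda>s. E s - W s)" by simp
      have "zero_at_infinity_ge \<theta>\<^sub>w (\<lambda>s. W s + (E s - W s))"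
        using w(2) zero_at_infinity_ge_mono[OF E'] by (intro zero_at_infinity_ge_add) auto
      then have "e \<in> X_set W \<theta>\<^sub>w \<theta>\<^sub>p" using e E' by (intro X_setI) auto
      with e(3) show ?thesis by blast
    qed
    then show "\<phi> \<in> mtopology_of C0_metric closure_of X_set W \<theta>\<^sub>w \<theta>\<^sub>p"
      unfolding in_closure_of_C0_iff[OF sub] using \<phi>(1) by blast
  qed
qed

text \<open>
  Here both order conditions say that the transform of \<open>e\<close> is \<open>O(1 / s)\<close>, which every combination
  of bumps satisfies.
\<close>

lemma closure_X_set_eq_C0:
  assumes "zero_at_infinity_ge 1 W"
  shows "mtopology_of C0_metric closure_of X_set W 1 0 = C0"
proof -
  have sub: "X_set W 1 0 \<subseteq> C0" by (auto simp: X_set_def)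
  have "\<exists>e\<in>X_set W 1 0. \<forall>t\<ge>0. \<bar>\<phi> t - e t\<bar> < \<epsilon>" if "\<phi> \<in> C0" "\<epsilon> > 0" for \<phi> \<epsilon>
  proof -
    obtain e E where e: "e \<in> C0" "has_laplace e E" "zero_at_infinity_ge 1 E"
      and close: "\<And>t. t \<ge> 0 \<Longrightarrow> \<bar>\<phi> t - e t\<bar> < \<epsilon>"
      using C0_approximation_by_bumps[OF \<open>\<phi> \<in> C0\<close> \<open>\<epsilon> > 0\<close>] by blast
    have "zero_at_infinity_ge (0 + 1) (\<lambda>s. E s - W s)"
      using e(3) assms unfolding zero_at_infinity_ge_def add_0 by (rule sum_in_bigo)
    with e have "e \<in> X_set W 1 0" by (intro X_setI)
    with close show ?thesis by blast
  qed
  then show ?thesis using in_closure_of_C0_iff[OF sub] by blast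
qed

theorem proposition3p2:
  fixes w :: "real \<Rightarrow> real" and W :: "complex \<Rightarrow> complex" and \<alpha> :: real
    and \<theta>\<^sub>w \<theta>\<^sub>p :: nat
  assumes "\<theta>\<^sub>w \<ge> 1"
    and "has_rational_laplace w W"
    and "zero_at_infinity_eq \<theta>\<^sub>w W"
    and "\<theta>\<^sub>p > 0 \<and> \<theta>\<^sub>w = 1 \<longrightarrow> (w \<longlongrightarrow> \<alpha>) (at_right 0)"
  shows "mtopology_of C0_metric closure_of X_set W \<theta>\<^sub>w \<theta>\<^sub>p =
    (if \<theta>\<^sub>p > 0 \<and> \<theta>\<^sub>w = 1 then C0_at \<alpha>
     else if \<theta>\<^sub>p = 0 \<and> \<theta>\<^sub>w = 1 then C0
     else C0_at 0)"
proof -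
  have w: "has_laplace w W" using assms(2) by (rule has_rational_laplace_imp_has_laplace)
  have W: "zero_at_infinity_ge \<theta>\<^sub>w W" using assms(3) by (simp add: zero_at_infinity_eq_def)
  consider (limit) "\<theta>\<^sub>p > 0" "\<theta>\<^sub>w = 1" | (free) "\<theta>\<^sub>p = 0" "\<theta>\<^sub>w = 1" | (zero) "\<theta>\<^sub>w > 1"
    using assms(1) by linarith
  then show ?thesis
  proof cases
    case limit
    then have "((\<lambda>s. s * W s) \<longlongrightarrow> of_real \<alpha>) at_infinity"
      using has_laplace_initial_value[OF w] W assms(4) by simp
    from closure_X_set_eq_C0_at[OF w W _ _ this] limit show ?thesis by simp
  next
    case free
    then show ?thesis using closure_X_set_eq_C0 W by simp
  next
    case zero
    then have "zero_at_infinity_ge (Suc 1) W"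
      by (intro zero_at_infinity_ge_mono[OF W]) simp
    from zero_at_infinity_ge_Suc_imp_tendsto_0[OF this]
    have "((\<lambda>s. s * W s) \<longlongrightarrow> of_real 0) at_infinity" by simp
    from closure_X_set_eq_C0_at[OF w W _ _ this] zero show ?thesis by simp
  qed
qed

end
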